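(* Let $f:[a,b]\to\mathbb{R}$ be $L$-Lipschitzian on $[a,b]$ and let $u:[a,b]\to\mathbb{R}$ be monotonic nondecreasing on $[a,b]$. Then $$|D(f;u)|\le \frac12 L(b-a)\left[u(b)-u(a)-K(u)\right]\le \frac12 L(b-a)\left[u(b)-u(a)\right],$$ where $$K(u):=\frac{4}{(b-a)^2}\int_a^b u(x)\left(x-\frac{a+b}{2}\right)dx=\frac{4}{(b-a)^2}\int_a^b\left[u(x)-u\left(\frac{a+b}{2}\right)\right]\left(x-\frac{a+b}{2}\right)dx\ge 0.$$ The constant $\frac12$ is sharp in both inequalities, in the sense that neither in the bound $|D(f;u)|\le \frac12 L(b-a)[u(b)-u(a)-K(u)]$ nor in the bound $|D(f;u)|\le\frac12 L(b-a)[u(b)-u(a)]$ can it be replaced by a smaller constant.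
   Context: $D(f;u):=\int_a^b f(x)\,du(x)-[u(b)-u(a)]\cdot\frac{1}{b-a}\int_a^b f(t)\,dt$, where the first integral is a Riemann–Stieltjes integral. $f$ is $L$-Lipschitzian on $[a,b]$ if $|f(x)-f(y)|\le L|x-y|$ for all $x,y\in[a,b]$. *)

theory Defs
  imports "HOL-Analysis.Analysis"
begin

(* Riemann-Stieltjes integral of f with respect to u as the limit of
   Riemann-Stieltjes sums when the mesh tends to 0, uniformly in the tags.
   Every member K of a tagged division of {a..b} is a nonempty closed interval
   {Inf K..Sup K}; degenerate intervals contribute 0 to the sum. *)
definition has_rs_integral ::
    "(real \<Rightarrow> real) \<Rightarrow> (real \<Rightarrow> real) \<Rightarrow> real \<Rightarrow> real \<Rightarrow> real \<Rightarrow> bool" where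
  "has_rs_integral f u a b I \<longleftrightarrow>
     (\<forall>e>0. \<exists>d>0. \<forall>p. p tagged_division_of {a..b} \<and> (\<forall>(x, K)\<in>p. Sup K - Inf K < d) \<longrightarrow>
        \<bar>(\<Sum>(x, K)\<in>p. f x * (u (Sup K) - u (Inf K))) - I\<bar> < e)"

(* The limit is unique for a \<le> b; the value is unspecified when the integral does not exist. *)
definition rs_integral ::
    "(real \<Rightarrow> real) \<Rightarrow> (real \<Rightarrow> real) \<Rightarrow> real \<Rightarrow> real \<Rightarrow> real" where
  "rs_integral f u a b = (THE I. has_rs_integral f u a b I)"

definition D_fun :: "real \<Rightarrow> real \<Rightarrow> (real \<Rightarrow> real) \<Rightarrow> (real \<Rightarrow> real) \<Rightarrow> real" where
  "D_fun a b f u =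
     rs_integral f u a b - (u b - u a) * (1 / (b - a) * integral {a..b} f)"

definition K_fun :: "real \<Rightarrow> real \<Rightarrow> (real \<Rightarrow> real) \<Rightarrow> real" where
  "K_fun a b u =
     4 / (b - a)\<^sup>2 * integral {a..b} (\<lambda>x. u x * (x - (a + b) / 2))"

end

theory Submission imports Defs begin

text \<open>Write \<open>m\<close> for the midpoint of \<open>[a, b]\<close> and \<open>M\<close> for the mean of \<open>f\<close>. Then \<open>D(f;u)\<close> is the
  difference of the integrals of \<open>f\<close> and of the constant \<open>M\<close> with respect to \<open>u\<close>. An \<open>L\<close>-Lipschitz
  function stays close to its mean: averaging \<open>|f x - f t| \<le> L |x - t|\<close> over \<open>t\<close> gives Ostrowski's
  inequality \<open>|f x - M| \<le> q x\<close> with \<open>q x = L (x - m)\<^sup>2 / (b - a) + L (b - a) / 4\<close>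
  (\<open>lipschitz_deviation_from_mean\<close>). Integrating this against a monotone \<open>u\<close> bounds \<open>|D(f;u)|\<close> by the
  integral of \<open>q\<close> with respect to \<open>u\<close>. Integration by parts evaluates that integral exactly:
  \<open>q a = q b = L (b - a) / 2\<close> yields the term with \<open>u b - u a\<close>, and \<open>q' x = 2 L (x - m) / (b - a)\<close>
  yields the correction by \<open>K(u)\<close>. So the refined bound is nothing but Ostrowski's inequality
  integrated.

  Two facts about the Riemann--Stieltjes integral carry this. Integration by parts for a
  differentiable integrand (\<open>has_rs_integral_by_parts\<close>) comes from the second mean value theorem
  applied on each cell of a tagged division; it yields existence and value at once. Existence for
  continuous integrands (\<open>continuous_has_rs_integral\<close>) then follows by approximating with
  polynomials.

  Both bounds are attained when \<open>f\<close> is linear with slope \<open>L\<close> and \<open>u\<close> jumps from \<open>0\<close> to \<open>1\<close> at \<open>b\<close>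
  (\<open>extremal_pair\<close>): the integral of \<open>f\<close> with respect to \<open>u\<close> is then \<open>f b\<close>, whose distance from the
  mean \<open>f m\<close> is \<open>L (b - a) / 2\<close>, while \<open>K(u) = 0\<close> because \<open>u\<close> vanishes almost everywhere.\<close>

section \<open>Riemann--Stieltjes sums and integrals\<close>

lemma tagged_division_of_interval_cell:
  fixes a b :: real
  assumes "p tagged_division_of {a..b}" "(x, K) \<in> p"
  obtains c d where "K = {c..d}" "c \<le> x" "x \<le> d" "a \<le> c" "d \<le> b" "Inf K = c" "Sup K = d"
proof -
  have x: "x \<in> K" and sub: "K \<subseteq> {a..b}" and "\<exists>c d. K = cbox c d"
    using tagged_division_ofD(2,3,4)[OF assms(1)] assms(2) by auto
  then obtain c d where K: "K = {c..d}" by auto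
  with x have cd: "c \<le> x" "x \<le> d" by auto
  moreover have "a \<le> c" "d \<le> b" using sub K cd by auto
  ultimately show thesis using that K by simp
qed

lemma tagged_division_of_small_mesh_exists:
  fixes a b :: real
  assumes "d > 0"
  obtains p where "p tagged_division_of {a..b}" "\<forall>(x, K)\<in>p. Sup K - Inf K < d"
proof -
  have "gauge (\<lambda>x::real. ball x (d/2))" using assms by auto
  then obtain p where p: "p tagged_division_of {a..b}" "(\<lambda>x. ball x (d/2)) fine p"
    using fine_division_exists_real by blast
  have "Sup K - Inf K < d" if xK: "(x, K) \<in> p" for x K
  proof -
    obtain c e where K: "K = {c..e}" "c \<le> x" "x \<le> e" "Inf K = c" "Sup K = e"
      using tagged_division_of_interval_cell[OF p(1) xK] by blast
    have "K \<subseteq> ball x (d/2)" using p(2) xK by (auto simp: fine_def)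
    moreover have "c \<in> K" "e \<in> K" using K by auto
    ultimately have "dist x c < d/2" "dist x e < d/2" by auto
    then show ?thesis using K by (auto simp: dist_real_def)
  qed
  then show thesis using that p(1) by blast
qed

definition rs_sum :: "(real \<Rightarrow> real) \<Rightarrow> (real \<Rightarrow> real) \<Rightarrow> (real \<times> real set) set \<Rightarrow> real" where
  "rs_sum f u p = (\<Sum>(x, K)\<in>p. f x * (u (Sup K) - u (Inf K)))"

lemma rs_sum_const:
  assumes "a \<le> b" "p tagged_division_of {a..b}"
  shows "rs_sum (\<lambda>x. c) u p = c * (u b - u a)"
  using additive_tagged_division_1[OF assms, of u]
  by (simp add: rs_sum_def case_prod_unfold flip: sum_distrib_left)

lemma rs_sum_diff: "rs_sum (\<lambda>x. f x - g x) u p = rs_sum f u p - rs_sum g u p"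
  by (simp add: rs_sum_def case_prod_unfold left_diff_distrib sum_subtractf)

lemma abs_rs_sum_le:
  assumes "p tagged_division_of {a..b}" "mono_on {a..b} u" "\<And>x. x \<in> {a..b} \<Longrightarrow> \<bar>f x\<bar> \<le> g x"
  shows "\<bar>rs_sum f u p\<bar> \<le> rs_sum g u p"
  unfolding rs_sum_def
proof (rule order_trans[OF sum_abs sum_mono], clarify)
  fix x K assume xK: "(x, K) \<in> p"
  obtain c d where K: "c \<le> x" "x \<le> d" "a \<le> c" "d \<le> b" "Inf K = c" "Sup K = d"
    using tagged_division_of_interval_cell[OF assms(1) xK] by blast
  have "u c \<le> u d" using K by (intro mono_onD[OF assms(2)]) auto
  then show "\<bar>f x * (u (Sup K) - u (Inf K))\<bar> \<le> g x * (u (Sup K) - u (Inf K))"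
    using assms(3)[of x] K by (auto simp: abs_mult intro!: mult_right_mono)
qed

lemma has_rs_integralD:
  assumes "has_rs_integral f u a b I" "e > 0"
  obtains d where "d > 0"
    "\<And>p. p tagged_division_of {a..b} \<Longrightarrow> \<forall>(x, K)\<in>p. Sup K - Inf K < d \<Longrightarrow> \<bar>rs_sum f u p - I\<bar> < e"
  using assms unfolding has_rs_integral_def rs_sum_def by meson

lemma has_rs_integralI:
  assumes "\<And>e. e > 0 \<Longrightarrow> \<exists>d>0. \<forall>p. p tagged_division_of {a..b} \<and>
    (\<forall>(x, K)\<in>p. Sup K - Inf K < d) \<longrightarrow> \<bar>rs_sum f u p - I\<bar> < e"
  shows "has_rs_integral f u a b I"
  using assms unfolding has_rs_integral_def rs_sum_def by blast

text \<open>Approximating several integrals over the same tagged division lets relations between sums pass to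
  the integrals. Three integrals are what the comparison of two integrands with a bound on their
  distance needs.\<close>

lemma has_rs_integral_common_division:
  assumes "has_rs_integral f u a b I" "has_rs_integral g u a b J" "has_rs_integral h u a b H" "e > 0"
  obtains p where "p tagged_division_of {a..b}"
    "\<bar>rs_sum f u p - I\<bar> < e" "\<bar>rs_sum g u p - J\<bar> < e" "\<bar>rs_sum h u p - H\<bar> < e"
proof -
  obtain d1 where d1: "d1 > 0" "\<And>p. p tagged_division_of {a..b} \<Longrightarrow>
      \<forall>(x, K)\<in>p. Sup K - Inf K < d1 \<Longrightarrow> \<bar>rs_sum f u p - I\<bar> < e"
    using has_rs_integralD[OF assms(1,4)] by blast
  obtain d2 where d2: "d2 > 0" "\<And>p. p tagged_division_of {a..b} \<Longrightarrow>
      \<forall>(x, K)\<in>p. Sup K - Inf K < d2 \<Longrightarrow> \<bar>rs_sum g u p - J\<bar> < e"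
    using has_rs_integralD[OF assms(2,4)] by blast
  obtain d3 where d3: "d3 > 0" "\<And>p. p tagged_division_of {a..b} \<Longrightarrow>
      \<forall>(x, K)\<in>p. Sup K - Inf K < d3 \<Longrightarrow> \<bar>rs_sum h u p - H\<bar> < e"
    using has_rs_integralD[OF assms(3,4)] by blast
  obtain p where p: "p tagged_division_of {a..b}"
      "\<forall>(x, K)\<in>p. Sup K - Inf K < min d1 (min d2 d3)"
    using tagged_division_of_small_mesh_exists[of "min d1 (min d2 d3)"] d1(1) d2(1) d3(1) by auto
  show thesis
    by (rule that[OF p(1) d1(2)[OF p(1)] d2(2)[OF p(1)] d3(2)[OF p(1)]]) (use p(2) in fastforce)+
qed

lemma has_rs_integral_unique:
  assumes "has_rs_integral f u a b I" "has_rs_integral f u a b J"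
  shows "I = J"
proof (rule ccontr)
  assume "I \<noteq> J"
  then have "\<bar>I - J\<bar> / 2 > 0" by simp
  then obtain p where "\<bar>rs_sum f u p - I\<bar> < \<bar>I - J\<bar> / 2" "\<bar>rs_sum f u p - J\<bar> < \<bar>I - J\<bar> / 2"
    using has_rs_integral_common_division[OF assms assms(2)] by blast
  then have "\<bar>I - J\<bar> < \<bar>I - J\<bar> / 2 + \<bar>I - J\<bar> / 2" by linarith
  then show False by simp
qed

lemma rs_integral_eq: "has_rs_integral f u a b I \<Longrightarrow> rs_integral f u a b = I"
  unfolding rs_integral_def by (blast intro: the_equality has_rs_integral_unique)

lemma has_rs_integral_const:
  assumes "a \<le> b"
  shows "has_rs_integral (\<lambda>x. c) u a b (c * (u b - u a))"
  by (intro has_rs_integralI exI[of _ 1]) (auto simp: rs_sum_const[OF assms])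

text \<open>A pointwise bound on the distance between two integrands passes to their integrals because the
  increments of a monotone integrator serve as nonnegative weights.\<close>

lemma has_rs_integral_abs_diff_le:
  assumes f: "has_rs_integral f u a b I" and g: "has_rs_integral g u a b J"
    and h: "has_rs_integral h u a b H"
    and u: "mono_on {a..b} u" and le: "\<And>x. x \<in> {a..b} \<Longrightarrow> \<bar>f x - g x\<bar> \<le> h x"
  shows "\<bar>I - J\<bar> \<le> H"
proof (rule field_le_epsilon)
  fix e :: real assume "e > 0"
  then have "e/3 > 0" by simp
  then obtain p where p: "p tagged_division_of {a..b}" and
    "\<bar>rs_sum f u p - I\<bar> < e/3" "\<bar>rs_sum g u p - J\<bar> < e/3" "\<bar>rs_sum h u p - H\<bar> < e/3"
    using has_rs_integral_common_division[OF f g h] by blast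
  moreover have "\<bar>rs_sum f u p - rs_sum g u p\<bar> \<le> rs_sum h u p"
    using abs_rs_sum_le[OF p u le] by (simp add: rs_sum_diff)
  ultimately show "\<bar>I - J\<bar> \<le> H + e" by linarith
qed

section \<open>Integration by parts and existence\<close>

text \<open>On a cell \<open>[c, h]\<close> the second mean value theorem gives the integral of \<open>u q'\<close> as
  \<open>u c (q t - q c) + u h (q h - q t)\<close> for some \<open>t\<close> in the cell. Subtracting this from the increment of
  \<open>q u\<close> leaves \<open>q t (u h - u c)\<close>, a Riemann--Stieltjes term with tag \<open>t\<close>. Hence the claimed value is
  itself a Riemann--Stieltjes sum over the given cells, only with other tags, and uniform continuity
  of \<open>q\<close> makes the change of tags harmless.\<close>

lemma has_rs_integral_by_parts:
  assumes ab: "a \<le> b" and u: "mono_on {a..b} u"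
    and q: "\<And>x. x \<in> {a..b} \<Longrightarrow> (q has_real_derivative q' x) (at x within {a..b})"
  shows "has_rs_integral q u a b (q b * u b - q a * u a - integral {a..b} (\<lambda>x. u x * q' x))"
proof (rule has_rs_integralI)
  fix e :: real assume e: "e > 0"
  have ftc: "(q' has_integral (q d - q c)) {c..d}" if "a \<le> c" "c \<le> d" "d \<le> b" for c d
    using that
    by (intro fundamental_theorem_of_calculus)
       (auto simp flip: has_real_derivative_iff_has_vector_derivative
             intro!: DERIV_subset[OF q])
  have um: "u x \<le> u y" if "a \<le> x" "x \<le> y" "y \<le> b" for x y
    using that by (intro mono_onD[OF u]) auto
  have smv: "\<exists>t\<in>{c..d}. ((\<lambda>x. u x * q' x) has_integral (u c * (q t - q c) + u d * (q d - q t))) {c..d}"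
    if cd: "a \<le> c" "c \<le> d" "d \<le> b" for c d
  proof -
    obtain t where t: "t \<in> {c..d}" "((\<lambda>x. u x * q' x) has_integral
        (u c * integral {c..t} q' + u d * integral {t..d} q')) {c..d}"
      by (rule second_mean_value_theorem_full[of q' c d u])
         (use ftc[OF cd] cd um in auto)
    moreover have "integral {c..t} q' = q t - q c" "integral {t..d} q' = q d - q t"
      using t(1) cd by (auto intro!: integral_unique ftc)
    ultimately show ?thesis by auto
  qed
  have int: "(\<lambda>x. u x * q' x) integrable_on {a..b}" using smv[of a b] ab by auto
  \<comment> \<open>The \<open>1\<close> in the denominator keeps \<open>w\<close> positive and the final bound strict when \<open>u\<close> is constant.\<close>
  define w where "w = e / (u b - u a + 1)"
  have uab: "u a \<le> u b" using um ab by auto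
  then have w: "w > 0" using e by (auto simp: w_def)
  have "continuous_on {a..b} q"
    using q by (meson DERIV_continuous_on)
  then have "uniformly_continuous_on {a..b} q"
    by (intro compact_uniformly_continuous) auto
  then obtain d where d: "d > 0"
    "\<And>x y. x \<in> {a..b} \<Longrightarrow> y \<in> {a..b} \<Longrightarrow> dist y x < d \<Longrightarrow> dist (q y) (q x) < w"
    using w unfolding uniformly_continuous_on_def by metis
  show "\<exists>d>0. \<forall>p. p tagged_division_of {a..b} \<and> (\<forall>(x, K)\<in>p. Sup K - Inf K < d) \<longrightarrow>
     \<bar>rs_sum q u p - (q b * u b - q a * u a - integral {a..b} (\<lambda>x. u x * q' x))\<bar> < e"
  proof (intro exI[of _ d] conjI d(1) allI impI)
    fix p assume "p tagged_division_of {a..b} \<and> (\<forall>(x, K)\<in>p. Sup K - Inf K < d)"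
    then have p: "p tagged_division_of {a..b}" and mesh: "\<And>x K. (x, K) \<in> p \<Longrightarrow> Sup K - Inf K < d"
      by auto
    have cell: "\<bar>q x * (u (Sup K) - u (Inf K)) - (q (Sup K) * u (Sup K) - q (Inf K) * u (Inf K))
        + integral K (\<lambda>x. u x * q' x)\<bar> \<le> w * (u (Sup K) - u (Inf K))" if xK: "(x, K) \<in> p" for x K
    proof -
      obtain c h where K: "K = {c..h}" "c \<le> x" "x \<le> h" "a \<le> c" "h \<le> b" "Inf K = c" "Sup K = h"
        using tagged_division_of_interval_cell[OF p xK] by blast
      obtain t where t: "t \<in> {c..h}" "((\<lambda>x. u x * q' x) has_integral
          (u c * (q t - q c) + u h * (q h - q t))) {c..h}" using smv[of c h] K by auto
      have "h - c < d" using mesh[OF xK] K by simp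
      then have "dist (q x) (q t) < w" using t(1) K by (intro d(2)) (auto simp: dist_real_def)
      then have qt: "\<bar>q x - q t\<bar> \<le> w" by (simp add: dist_real_def)
      have "q x * (u h - u c) - (q h * u h - q c * u c) + integral {c..h} (\<lambda>x. u x * q' x)
          = (q x - q t) * (u h - u c)"
        using integral_unique[OF t(2)] by (simp add: algebra_simps)
      moreover have "u c \<le> u h" using um K by auto
      then have "\<bar>(q x - q t) * (u h - u c)\<bar> \<le> w * (u h - u c)"
        using qt by (auto simp: abs_mult intro!: mult_right_mono)
      ultimately show ?thesis using K by metis
    qed
    have "(\<Sum>(x, K)\<in>p. q (Sup K) * u (Sup K) - q (Inf K) * u (Inf K)) = q b * u b - q a * u a"
      using additive_tagged_division_1[OF ab p, of "\<lambda>x. q x * u x"] by simp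
    moreover have "(\<Sum>(x, K)\<in>p. integral K (\<lambda>x. u x * q' x)) = integral {a..b} (\<lambda>x. u x * q' x)"
      using integral_combine_tagged_division_topdown[of "\<lambda>x. u x * q' x" a b p] int p by simp
    ultimately have "rs_sum q u p - (q b * u b - q a * u a - integral {a..b} (\<lambda>x. u x * q' x))
      = (\<Sum>(x, K)\<in>p. q x * (u (Sup K) - u (Inf K)) - (q (Sup K) * u (Sup K) - q (Inf K) * u (Inf K))
        + integral K (\<lambda>x. u x * q' x))"
      unfolding rs_sum_def by (simp add: case_prod_unfold sum.distrib sum_subtractf)
    also have "\<bar>\<dots>\<bar> \<le> rs_sum (\<lambda>x. w) u p"
      unfolding rs_sum_def by (rule order_trans[OF sum_abs sum_mono]) (use cell in auto)
    also have "\<dots> = w * (u b - u a)" by (rule rs_sum_const[OF ab p])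
    also have "\<dots> < w * (u b - u a + 1)" using w by (simp add: algebra_simps)
    also have "\<dots> = e" using uab by (simp add: w_def)
    finally show "\<bar>rs_sum q u p - (q b * u b - q a * u a - integral {a..b} (\<lambda>x. u x * q' x))\<bar> < e" .
  qed
qed

text \<open>Polynomials are integrable by parts. The integral is Lipschitz in the integrand for the uniform
  norm, with constant \<open>u b - u a\<close>, so the integrals of approximating polynomials form a Cauchy
  sequence; the same estimate for sums shows that its limit is the integral of \<open>f\<close>.\<close>

lemma continuous_has_rs_integral:
  assumes ab: "a \<le> b" and u: "mono_on {a..b} u" and f: "continuous_on {a..b} f"
  obtains I where "has_rs_integral f u a b I"
proof -
  have uab: "u a \<le> u b" using u ab by (auto intro: mono_onD)
  have ex: "\<exists>g I. (\<forall>x\<in>{a..b}. \<bar>f x - g x\<bar> \<le> e) \<and> has_rs_integral g u a b I" if "e > 0" for e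
  proof -
    obtain g where g: "real_polynomial_function g" "\<And>x. x \<in> {a..b} \<Longrightarrow> \<bar>f x - g x\<bar> < e"
      using Stone_Weierstrass_real_polynomial_function[OF _ f \<open>e > 0\<close>] by auto
    obtain g' where "\<And>x. (g has_real_derivative g' x) (at x)"
      using has_real_derivative_polynomial_function[OF g(1)] by blast
    then have "(g has_real_derivative g' x) (at x within {a..b})" for x
      using has_field_derivative_at_within by blast
    then show ?thesis using has_rs_integral_by_parts[OF ab u] g(2) by (meson less_imp_le)
  qed
  define r where "r n = 1 / real (Suc n)" for n
  have r: "r n > 0" for n by (simp add: r_def)
  have "\<exists>g I. \<forall>n. (\<forall>x\<in>{a..b}. \<bar>f x - g n x\<bar> \<le> r n) \<and> has_rs_integral (g n) u a b (I n)"
    using ex[OF r] by metis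
  then obtain g I where g: "\<And>n x. x \<in> {a..b} \<Longrightarrow> \<bar>f x - g n x\<bar> \<le> r n"
    and I: "\<And>n. has_rs_integral (g n) u a b (I n)" by blast
  have bound: "\<bar>I m - I n\<bar> \<le> (r m + r n) * (u b - u a)" for m n
    by (rule has_rs_integral_abs_diff_le[OF I I has_rs_integral_const[OF ab] u])
       (use g[of _ m] g[of _ n] in fastforce)
  have r0: "r \<longlonglongrightarrow> 0" unfolding r_def by (rule LIMSEQ_Suc[OF lim_1_over_n])
  have small: "\<exists>N. \<forall>n\<ge>N. r n * (u b - u a) < e" if "e > 0" for e
  proof -
    have "(\<lambda>n. r n * (u b - u a)) \<longlonglongrightarrow> 0" by (rule tendsto_mult_left_zero[OF r0])
    from order_tendstoD(2)[OF this that] show ?thesis by (auto simp: eventually_sequentially)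
  qed
  have "Cauchy I"
  proof (rule CauchyI)
    fix e :: real assume "e > 0"
    then obtain N where N: "\<And>n. n \<ge> N \<Longrightarrow> r n * (u b - u a) < e/2" using small[of "e/2"] by auto
    have "norm (I m - I n) < e" if "m \<ge> N" "n \<ge> N" for m n
      using bound[of m n] N[OF that(1)] N[OF that(2)] by (simp add: distrib_right)
    then show "\<exists>M. \<forall>m\<ge>M. \<forall>n\<ge>M. norm (I m - I n) < e" by blast
  qed
  then obtain J where J: "I \<longlonglongrightarrow> J" using Cauchy_convergent convergentD by blast
  have "has_rs_integral f u a b J"
  proof (rule has_rs_integralI)
    fix e :: real assume e: "e > 0"
    obtain N where N: "\<And>n. n \<ge> N \<Longrightarrow> r n * (u b - u a) < e/3" using small[of "e/3"] e by auto
    obtain M where M: "\<And>n. n \<ge> M \<Longrightarrow> \<bar>I n - J\<bar> < e/3"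
      using LIMSEQ_D[OF J, of "e/3"] e by auto
    define n where "n = max M N"
    obtain d where d: "d > 0" "\<And>p. p tagged_division_of {a..b} \<Longrightarrow>
        \<forall>(x, K)\<in>p. Sup K - Inf K < d \<Longrightarrow> \<bar>rs_sum (g n) u p - I n\<bar> < e/3"
      using has_rs_integralD[OF I, of "e/3" n] e by auto
    have "\<bar>rs_sum f u p - J\<bar> < e"
      if p: "p tagged_division_of {a..b}" "\<forall>(x, K)\<in>p. Sup K - Inf K < d" for p
    proof -
      have "\<bar>rs_sum f u p - rs_sum (g n) u p\<bar> \<le> r n * (u b - u a)"
        using abs_rs_sum_le[OF p(1) u, of "\<lambda>x. f x - g n x" "\<lambda>x. r n"] g
        by (simp add: rs_sum_diff rs_sum_const[OF ab p(1)])
      moreover have "r n * (u b - u a) < e/3" "\<bar>I n - J\<bar> < e/3" using N M by (auto simp: n_def)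
      moreover have "\<bar>rs_sum (g n) u p - I n\<bar> < e/3" by (rule d(2)[OF p])
      ultimately show ?thesis by linarith
    qed
    then show "\<exists>d>0. \<forall>p. p tagged_division_of {a..b} \<and> (\<forall>(x, K)\<in>p. Sup K - Inf K < d) \<longrightarrow>
        \<bar>rs_sum f u p - J\<bar> < e" using d(1) by blast
  qed
  then show thesis by (rule that)
qed

section \<open>Deviation of a Lipschitz function from its mean\<close>

text \<open>Ostrowski's inequality. The right-hand side is the mean of \<open>L |x - t|\<close> over \<open>t\<close>, that is
  \<open>L ((x - a)\<^sup>2 + (b - x)\<^sup>2) / (2 (b - a))\<close>, with the square completed around the midpoint.\<close>

lemma lipschitz_deviation_from_mean:
  fixes f :: "real \<Rightarrow> real"
  assumes ab: "a < b" and f: "L-lipschitz_on {a..b} f" and x: "x \<in> {a..b}"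
  shows "\<bar>f x - 1 / (b - a) * integral {a..b} f\<bar>
    \<le> L / (b - a) * (x - (a + b) / 2)\<^sup>2 + L * (b - a) / 4"
proof -
  have fi: "f integrable_on {a..b}"
    by (intro integrable_continuous_real lipschitz_on_continuous_on[OF f])
  have "((\<lambda>t. L * (x - t)) has_integral (- L * (x - x)\<^sup>2 / 2 - (- L * (x - a)\<^sup>2 / 2))) {a..x}"
    using x by (intro fundamental_theorem_of_calculus)
      (auto intro!: derivative_eq_intros simp: field_simps
            simp flip: has_real_derivative_iff_has_vector_derivative)
  then have 1: "((\<lambda>t. L * \<bar>x - t\<bar>) has_integral (L * (x - a)\<^sup>2 / 2)) {a..x}"
    by (rule has_integral_eq_rhs[OF has_integral_eq, rotated]) auto
  have "((\<lambda>t. L * (t - x)) has_integral (L * (b - x)\<^sup>2 / 2 - L * (x - x)\<^sup>2 / 2)) {x..b}"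
    using x by (intro fundamental_theorem_of_calculus)
      (auto intro!: derivative_eq_intros simp flip: has_real_derivative_iff_has_vector_derivative)
  then have 2: "((\<lambda>t. L * \<bar>x - t\<bar>) has_integral (L * (b - x)\<^sup>2 / 2)) {x..b}"
    by (rule has_integral_eq_rhs[OF has_integral_eq, rotated]) auto
  have 3: "((\<lambda>t. L * \<bar>x - t\<bar>) has_integral (L * (x - a)\<^sup>2 / 2 + L * (b - x)\<^sup>2 / 2)) {a..b}"
    using has_integral_combine[OF _ _ 1 2] x by auto
  have 4: "((\<lambda>t. f x - f t) has_integral (f x * (b - a) - integral {a..b} f)) {a..b}"
    using has_integral_diff[OF has_integral_const_real[of "f x" a b] integrable_integral[OF fi]] ab
    by (simp add: mult.commute)
  have "norm (integral {a..b} (\<lambda>t. f x - f t)) \<le> integral {a..b} (\<lambda>t. L * \<bar>x - t\<bar>)"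
    using 3 4 lipschitz_onD[OF f x]
    by (intro integral_norm_bound_integral) (auto simp: dist_real_def)
  then have 5: "\<bar>f x * (b - a) - integral {a..b} f\<bar> \<le> L * (x - a)\<^sup>2 / 2 + L * (b - x)\<^sup>2 / 2"
    using integral_unique[OF 3] integral_unique[OF 4] by simp
  have "\<bar>f x - 1 / (b - a) * integral {a..b} f\<bar> = \<bar>f x * (b - a) - integral {a..b} f\<bar> / (b - a)"
    using ab by (simp add: field_simps abs_divide)
  also have "\<dots> \<le> (L * (x - a)\<^sup>2 / 2 + L * (b - x)\<^sup>2 / 2) / (b - a)"
    using 5 ab by (intro divide_right_mono) auto
  also have "\<dots> = L / (b - a) * (x - (a + b) / 2)\<^sup>2 + L * (b - a) / 4"
    using ab by (simp add: field_simps power2_eq_square)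
  finally show ?thesis .
qed

section \<open>The bounds and their sharpness\<close>

text \<open>Subtracting a constant from \<open>u\<close> does not change the integral because \<open>x - m\<close> has integral zero. With
  the constant \<open>u m\<close>, monotonicity makes the two factors of the integrand agree in sign.\<close>

lemma K_fun_centred:
  assumes ab: "a < b" and u: "mono_on {a..b} u"
  shows "K_fun a b u = 4 / (b - a)\<^sup>2 *
      integral {a..b} (\<lambda>x. (u x - u ((a + b) / 2)) * (x - (a + b) / 2))"
    and "K_fun a b u \<ge> 0"
proof -
  let ?m = "(a + b) / 2"
  have "((\<lambda>x. x - ?m) has_integral ((b - ?m)\<^sup>2 / 2 - (a - ?m)\<^sup>2 / 2)) {a..b}"
    using ab by (intro fundamental_theorem_of_calculus)
      (auto intro!: derivative_eq_intros simp flip: has_real_derivative_iff_has_vector_derivative)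
  then have 0: "((\<lambda>x. x - ?m) has_integral 0) {a..b}"
    by (rule has_integral_eq_rhs) (simp add: field_simps power2_eq_square)
  have "(\<lambda>x. u x * (x - ?m)) integrable_on {a..b}"
    by (rule second_mean_value_theorem_full[of "\<lambda>x. x - ?m" a b u])
       (use 0 ab in \<open>auto intro: mono_onD[OF u]\<close>)
  from has_integral_diff[OF integrable_integral[OF this] has_integral_mult_right[OF 0, of "u ?m"]]
  have c: "((\<lambda>x. (u x - u ?m) * (x - ?m)) has_integral integral {a..b} (\<lambda>x. u x * (x - ?m))) {a..b}"
    by (simp add: left_diff_distrib)
  then show eq: "K_fun a b u = 4 / (b - a)\<^sup>2 * integral {a..b} (\<lambda>x. (u x - u ?m) * (x - ?m))"
    by (simp add: K_fun_def integral_unique)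
  have "0 \<le> (u x - u ?m) * (x - ?m)" if "x \<in> {a..b}" for x
  proof (cases "x \<le> ?m")
    case True
    then have "u x \<le> u ?m" using that ab by (intro mono_onD[OF u]) auto
    with True show ?thesis by (intro mult_nonpos_nonpos) auto
  next
    case False
    then have "u ?m \<le> u x" using that ab by (intro mono_onD[OF u]) auto
    with False show ?thesis by (intro mult_nonneg_nonneg) auto
  qed
  then have "0 \<le> integral {a..b} (\<lambda>x. (u x - u ?m) * (x - ?m))"
    using c by (intro integral_nonneg) auto
  then show "K_fun a b u \<ge> 0" unfolding eq by simp
qed

lemma abs_D_fun_le:
  assumes ab: "a < b" and f: "L-lipschitz_on {a..b} f" and u: "mono_on {a..b} u"
  shows "\<bar>D_fun a b f u\<bar> \<le> 1 / 2 * L * (b - a) * (u b - u a - K_fun a b u)"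
proof -
  let ?m = "(a + b) / 2"
  let ?q = "\<lambda>x. L / (b - a) * (x - ?m)\<^sup>2 + L * (b - a) / 4"
  have ab': "a \<le> b" using ab by simp
  obtain I where I: "has_rs_integral f u a b I"
    using continuous_has_rs_integral[OF ab' u lipschitz_on_continuous_on[OF f]] .
  have "has_rs_integral ?q u a b (?q b * u b - ?q a * u a
      - integral {a..b} (\<lambda>x. u x * (2 * L / (b - a) * (x - ?m))))"
    by (rule has_rs_integral_by_parts[OF ab' u]) (use ab in \<open>auto intro!: derivative_eq_intros\<close>)
  from has_rs_integral_abs_diff_le[OF I has_rs_integral_const[OF ab'] this u
      lipschitz_deviation_from_mean[OF ab f]]
  have "\<bar>D_fun a b f u\<bar> \<le> ?q b * u b - ?q a * u a
      - integral {a..b} (\<lambda>x. u x * (2 * L / (b - a) * (x - ?m)))"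
    by (simp add: D_fun_def rs_integral_eq[OF I] mult.commute)
  also have "integral {a..b} (\<lambda>x. u x * (2 * L / (b - a) * (x - ?m)))
      = 2 * L / (b - a) * integral {a..b} (\<lambda>x. u x * (x - ?m))"
    by (subst integral_mult_right[symmetric]) (simp add: mult_ac)
  also have "\<dots> = 1 / 2 * L * (b - a) * K_fun a b u"
    using ab by (simp add: K_fun_def power2_eq_square)
  also have "?q b = 1 / 2 * L * (b - a)"
    using ab by (simp add: field_simps power2_eq_square)
  also have "?q a = 1 / 2 * L * (b - a)"
    using ab by (simp add: field_simps power2_eq_square)
  finally show ?thesis by (simp only: right_diff_distrib)
qed

lemma integral_jump_at_right_end:
  fixes g :: "real \<Rightarrow> real"
  shows "integral {a..b} (\<lambda>x. (if x = b then 1 else 0) * g x) = 0"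
  by (rule integral_unique, rule has_integral_spike_finite[of "{b}" _ _ "\<lambda>x. 0"]) auto

text \<open>Ostrowski's inequality is an equality at \<open>x = b\<close> for linear \<open>f\<close>, and this \<open>u\<close> puts all its mass
  there.\<close>

lemma extremal_pair:
  fixes a b :: real
  assumes ab: "a < b" and L: "L > 0"
  defines "u \<equiv> \<lambda>x. if x = b then 1 else (0 :: real)"
  shows "L-lipschitz_on {a..b} (\<lambda>x. L * x)" "mono_on {a..b} u"
    "u b - u a = 1" "K_fun a b u = 0" "D_fun a b (\<lambda>x. L * x) u = 1 / 2 * L * (b - a)"
proof -
  show "L-lipschitz_on {a..b} (\<lambda>x. L * x)"
    using L by (intro lipschitz_onI) (auto simp: dist_real_def abs_mult simp flip: right_diff_distrib)
  show u: "mono_on {a..b} u" by (auto simp: mono_on_def u_def)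
  show uab: "u b - u a = 1" using ab by (simp add: u_def)
  show "K_fun a b u = 0" by (simp only: K_fun_def u_def integral_jump_at_right_end mult_zero_right)
  have "has_rs_integral (\<lambda>x. L * x) u a b
      (L * b * u b - L * a * u a - integral {a..b} (\<lambda>x. u x * L))"
    using ab by (intro has_rs_integral_by_parts u) (auto intro!: derivative_eq_intros)
  moreover have "integral {a..b} (\<lambda>x. u x * L) = 0"
    unfolding u_def by (rule integral_jump_at_right_end)
  ultimately have "rs_integral (\<lambda>x. L * x) u a b = L * b"
    using ab by (simp add: rs_integral_eq u_def)
  moreover have "((\<lambda>x. L * x) has_integral (L * b\<^sup>2 / 2 - L * a\<^sup>2 / 2)) {a..b}"
    using ab by (intro fundamental_theorem_of_calculus)
      (auto intro!: derivative_eq_intros simp flip: has_real_derivative_iff_has_vector_derivative)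
  then have "1 / (b - a) * integral {a..b} (\<lambda>x. L * x) = L * (a + b) / 2"
    using ab by (simp only: integral_unique) (simp add: divide_simps power2_eq_square; algebra)
  ultimately show "D_fun a b (\<lambda>x. L * x) u = 1 / 2 * L * (b - a)"
    by (simp add: D_fun_def uab) (simp add: field_simps)
qed

theorem theorem13:
  fixes a b :: real
  assumes "a < b"
  shows "(\<forall>L f u. L-lipschitz_on {a..b} f \<and> mono_on {a..b} u \<longrightarrow>
            \<bar>D_fun a b f u\<bar> \<le> 1 / 2 * L * (b - a) * (u b - u a - K_fun a b u) \<and>
            1 / 2 * L * (b - a) * (u b - u a - K_fun a b u) \<le> 1 / 2 * L * (b - a) * (u b - u a) \<and>
            K_fun a b u =
              4 / (b - a)\<^sup>2 *
                integral {a..b} (\<lambda>x. (u x - u ((a + b) / 2)) * (x - (a + b) / 2)) \<and>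
            K_fun a b u \<ge> 0) \<and>
         (\<forall>L>0. \<forall>c<1 / 2.
            \<not> (\<forall>f u. L-lipschitz_on {a..b} f \<and> mono_on {a..b} u \<longrightarrow>
                  \<bar>D_fun a b f u\<bar> \<le> c * L * (b - a) * (u b - u a - K_fun a b u))) \<and>
         (\<forall>L>0. \<forall>c<1 / 2.
            \<not> (\<forall>f u. L-lipschitz_on {a..b} f \<and> mono_on {a..b} u \<longrightarrow>
                  \<bar>D_fun a b f u\<bar> \<le> c * L * (b - a) * (u b - u a)))"
proof (intro conjI allI impI)
  fix L :: real and f u :: "real \<Rightarrow> real"
  assume "L-lipschitz_on {a..b} f \<and> mono_on {a..b} u"
  then have f: "L-lipschitz_on {a..b} f" and u: "mono_on {a..b} u" by auto
  show "\<bar>D_fun a b f u\<bar> \<le> 1 / 2 * L * (b - a) * (u b - u a - K_fun a b u)"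
    by (rule abs_D_fun_le[OF assms f u])
  show "K_fun a b u = 4 / (b - a)\<^sup>2 *
      integral {a..b} (\<lambda>x. (u x - u ((a + b) / 2)) * (x - (a + b) / 2))"
    by (rule K_fun_centred(1)[OF assms u])
  show K: "K_fun a b u \<ge> 0" by (rule K_fun_centred(2)[OF assms u])
  show "1 / 2 * L * (b - a) * (u b - u a - K_fun a b u) \<le> 1 / 2 * L * (b - a) * (u b - u a)"
    using K lipschitz_on_nonneg[OF f] assms by (intro mult_left_mono) auto
next
  fix L c :: real
  assume "0 < L" "c < 1 / 2"
  define u where "u x = (if x = b then 1 else (0 :: real))" for x
  note ex = extremal_pair[OF assms \<open>0 < L\<close>, folded u_def]
  have "0 < L * (b - a)" using assms \<open>0 < L\<close> by simp
  from mult_strict_right_mono[OF \<open>c < 1 / 2\<close> this] this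
  have less: "c * L * (b - a) < \<bar>D_fun a b (\<lambda>x. L * x) u\<bar>"
    unfolding ex(5) by (simp add: mult.assoc)
  show "\<not> (\<forall>f u. L-lipschitz_on {a..b} f \<and> mono_on {a..b} u \<longrightarrow>
      \<bar>D_fun a b f u\<bar> \<le> c * L * (b - a) * (u b - u a - K_fun a b u))"
  proof
    assume "\<forall>f u. L-lipschitz_on {a..b} f \<and> mono_on {a..b} u \<longrightarrow>
      \<bar>D_fun a b f u\<bar> \<le> c * L * (b - a) * (u b - u a - K_fun a b u)"
    from this[rule_format, OF conjI[OF ex(1,2)]] less show False by (simp add: ex(3,4))
  qed
  show "\<not> (\<forall>f u. L-lipschitz_on {a..b} f \<and> mono_on {a..b} u \<longrightarrow>
      \<bar>D_fun a b f u\<bar> \<le> c * L * (b - a) * (u b - u a))"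
  proof
    assume "\<forall>f u. L-lipschitz_on {a..b} f \<and> mono_on {a..b} u \<longrightarrow>
      \<bar>D_fun a b f u\<bar> \<le> c * L * (b - a) * (u b - u a)"
    from this[rule_format, OF conjI[OF ex(1,2)]] less show False by (simp add: ex(3))
  qed
qed

end
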